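(* Let $L:\mathbb{R}^d\to\mathbb{R}_+$ be symmetric and quasiconvex with $L(0)=0$, and suppose there exists $\gamma<\infty$ such that $L(t)\le\gamma L(t/2)$ for all $t\in\mathbb{R}^d$. Let $\mathcal{P}$ be a family of distributions on $\mathcal{X}$ with parameter $\theta:\mathcal{P}\to\Theta\subset\mathbb{R}^d$ and let $P_0\in\mathcal{P}$. Let $\varepsilon\ge0$, $\delta_\varepsilon=\frac{e^\varepsilon}{e^\varepsilon+1}-\frac12$, and let $\mathcal{Q}$ be the collection of non-interactive $\varepsilon$-differentially private channels. Then for every $n\in\mathbb{N}$, $$\mathfrak{M}^{\mathrm{loc}}_n(P_0,L,\mathcal{P},\mathcal{Q})\ \le\ 2\gamma\,\sup_{\tau\ge0}\left\{\omega_L\!\left(\frac{\sqrt2\,\tau}{\delta_\varepsilon\sqrt n};P_0,\mathcal{P}\right)e^{-\tau^2}\right\}.$$ (When $\varepsilon=0$, the radius $\sqrt2\tau/(\delta_\varepsilon\sqrt n)$ is read as $+\infty$.)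
   Context: Data $X_1,\dots,X_n$ are i.i.d. from $P$ on $\mathcal{X}$. A non-interactive channel is a Markov kernel $Q(\cdot\mid x)$ from $\mathcal{X}$ to some $\mathcal{Z}$, with $Z_i\mid X_i=x\sim Q(\cdot\mid x)$; it is $\varepsilon$-locally differentially private if $Q(A\mid x)\le e^{\varepsilon}Q(A\mid x')$ for all $x,x'\in\mathcal{X}$ and measurable $A$. Symmetric means $L(-t)=L(t)$. The local minimax risk is $$\mathfrak{M}^{\mathrm{loc}}_n(P_0,L,\mathcal{P},\mathcal{Q})=\sup_{P_1\in\mathcal{P}}\ \inf_{\hat\theta,\,Q\in\mathcal{Q}}\ \max_{P\in\{P_0,P_1\}}\mathbb{E}_{Q\circ P}\big[L(\hat\theta(Z_1,\dots,Z_n)-\theta(P))\big],$$ where $Q\circ P$ denotes the law of $Z_{1:n}$ when $X_i\overset{iid}{\sim}P$ and $Z_i$ are drawn from $Q$, and the infimum is over all estimators $\hat\theta$ of $Z_{1:n}$. The modulus of continuity is $$\omega_L(\delta;P_0,\mathcal{P})=\sup_{P\in\mathcal{P}}\Big\{L\Big(\frac{\theta(P_0)-\theta(P)}{2}\Big)\ :\ \|P-P_0\|_{TV}\le\delta\Big\},\qquad \|P-P_0\|_{TV}=\sup_A|P(A)-P_0(A)|.$$ *)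

theory Defs
  imports "HOL-Probability.Probability"
begin

definition quasiconvex :: "('a::real_vector \<Rightarrow> real) \<Rightarrow> bool" where
  "quasiconvex f \<longleftrightarrow>
     (\<forall>x y. \<forall>u\<in>{0..1}. f ((1 - u) *\<^sub>R x + u *\<^sub>R y) \<le> max (f x) (f y))"

text \<open>Intended for probability measures with \<open>sets P = sets P'\<close>, where the supremum is over
  a nonempty set of reals bounded by 1.\<close>

definition tv_dist :: "'x measure \<Rightarrow> 'x measure \<Rightarrow> real" where
  "tv_dist P P' = (SUP A\<in>sets P. \<bar>measure P A - measure P' A\<bar>)"

text \<open>A channel is a pair of an output measurable space and a Markov kernel into it. The output
  space is part of the channel, so it ranges over all measurable spaces whose points are of
  type \<open>'z\<close>.\<close>

definition private_channels ::
    "real \<Rightarrow> 'x measure \<Rightarrow> ('z measure \<times> ('x \<Rightarrow> 'z measure)) set" where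
  "private_channels \<epsilon> X = {(Z, Q). Q \<in> X \<rightarrow>\<^sub>M prob_algebra Z \<and>
     (\<forall>x\<in>space X. \<forall>x'\<in>space X. \<forall>A\<in>sets Z. measure (Q x) A \<le> exp \<epsilon> * measure (Q x') A)}"

text \<open>The joint law of \<open>Z\<^sub>1, \<dots>, Z\<^sub>n\<close>: draw \<open>X\<^sub>1, \<dots>, X\<^sub>n\<close> i.i.d. from \<open>P\<close>, then draw
  each \<open>Z\<^sub>i\<close> independently from \<open>Q X\<^sub>i\<close>.\<close>

definition private_law ::
    "nat \<Rightarrow> ('x \<Rightarrow> 'z measure) \<Rightarrow> 'x measure \<Rightarrow> (nat \<Rightarrow> 'z) measure" where
  "private_law n Q P =
     Pi\<^sub>M {..<n} (\<lambda>_. P) \<bind> (\<lambda>x. Pi\<^sub>M {..<n} (\<lambda>i. Q (x i)))"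

text \<open>Estimators are measurable with values in \<open>\<Theta>\<close>; taking \<open>\<Theta> = UNIV\<close> gives
  unrestricted estimators. For a Borel loss \<open>L\<close> the second condition is automatic. A quasiconvex
  \<open>L\<close> need not be Borel in dimension at least 2, and then the condition keeps only those
  estimators whose expected loss is a genuine integral (\<open>nn_integral\<close> would otherwise be
  a lower integral). It only makes the infimum below larger.\<close>

definition estimators ::
    "nat \<Rightarrow> 'z measure \<Rightarrow> ('a::euclidean_space \<Rightarrow> real) \<Rightarrow> ('x measure \<Rightarrow> 'a) \<Rightarrow> 'a set \<Rightarrow>
     'x measure set \<Rightarrow> ((nat \<Rightarrow> 'z) \<Rightarrow> 'a) set" where
  "estimators n Z L \<theta> \<Theta> \<P> =
     {T. T \<in> Pi\<^sub>M {..<n} (\<lambda>_. Z) \<rightarrow>\<^sub>M restrict_space borel \<Theta> \<and>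
         (\<forall>P\<in>\<P>. (\<lambda>z. L (T z - \<theta> P)) \<in> borel_measurable (Pi\<^sub>M {..<n} (\<lambda>_. Z)))}"

definition risk ::
    "nat \<Rightarrow> ('a::euclidean_space \<Rightarrow> real) \<Rightarrow> ('x measure \<Rightarrow> 'a) \<Rightarrow> ('x \<Rightarrow> 'z measure) \<Rightarrow>
     ((nat \<Rightarrow> 'z) \<Rightarrow> 'a) \<Rightarrow> 'x measure \<Rightarrow> ennreal" where
  "risk n L \<theta> Q T P = (\<integral>\<^sup>+ z. ennreal (L (T z - \<theta> P)) \<partial>private_law n Q P)"

definition local_minimax_risk ::
    "nat \<Rightarrow> 'x measure \<Rightarrow> ('a::euclidean_space \<Rightarrow> real) \<Rightarrow> ('x measure \<Rightarrow> 'a) \<Rightarrow> 'a set \<Rightarrow>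
     'x measure set \<Rightarrow> ('z measure \<times> ('x \<Rightarrow> 'z measure)) set \<Rightarrow> ennreal" where
  "local_minimax_risk n P0 L \<theta> \<Theta> \<P> \<Q> =
     (SUP P1\<in>\<P>. INF (Z, Q)\<in>\<Q>. INF T\<in>estimators n Z L \<theta> \<Theta> \<P>.
        MAX P\<in>{P0, P1}. risk n L \<theta> Q T P)"

definition loss_modulus ::
    "('a::euclidean_space \<Rightarrow> real) \<Rightarrow> ('x measure \<Rightarrow> 'a) \<Rightarrow> ereal \<Rightarrow> 'x measure \<Rightarrow>
     'x measure set \<Rightarrow> ennreal" where
  "loss_modulus L \<theta> r P0 \<P> =
     (SUP P\<in>{P\<in>\<P>. ereal (tv_dist P P0) \<le> r}. ennreal (L ((1/2) *\<^sub>R (\<theta> P0 - \<theta> P))))"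

definition privacy_delta :: "real \<Rightarrow> real" where
  "privacy_delta \<epsilon> = exp \<epsilon> / (exp \<epsilon> + 1) - 1/2"

definition privacy_radius :: "real \<Rightarrow> nat \<Rightarrow> real \<Rightarrow> ereal" where
  "privacy_radius \<epsilon> n \<tau> =
     (if \<epsilon> = 0 then \<infinity> else ereal (sqrt 2 * \<tau> / (privacy_delta \<epsilon> * sqrt (real n))))"

end

theory Submission
  imports Defs
begin

text \<open>
  Fix the alternative \<open>P1\<close>. An upper bound on the risk only asks for one private channel and one
  estimator, and two points call for nothing more than a private test of \<open>P0\<close> against \<open>P1\<close>.
  Let \<open>t\<close> be the total variation distance of \<open>P0\<close> and \<open>P1\<close> and let \<open>\<delta>\<close> be
  \<open>privacy_delta \<epsilon>\<close>. Hahn's decomposition theorem gives one event \<open>A\<close> with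
  \<open>P1 A - P0 A = t\<close> (\<open>tv_dist_attained\<close>). Each individual reports the bit \<open>x \<in> A\<close> by
  randomized response, telling the truth with probability \<open>1/2 + \<delta>\<close>, the largest that privacy
  allows. The privatised sample is then i.i.d. (\<open>private_law_eq_PiM\<close>), and the probability of
  a positive report is an affine function of \<open>P A\<close> with slope \<open>2 * \<delta>\<close>
  (\<open>measure_bind_randomized_response\<close>), so it is \<open>2 * \<delta> * t\<close> larger under \<open>P1\<close> than
  under \<open>P0\<close>.

  The estimator returns \<open>\<theta> P1\<close> or \<open>\<theta> P0\<close> according to the side of the midpoint on which the
  observed frequency of positive reports falls. A wrong answer is a deviation of the frequency by
  at least \<open>\<delta> * t\<close>, which by Hoeffding's inequality has probability at most
  \<open>exp (- 2 * n * (\<delta> * t)\<^sup>2)\<close>; it costs \<open>L (\<theta> P0 - \<theta> P1)\<close>, and a right answer costs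
  nothing (\<open>two_point_risk_le\<close>). The growth condition trades that loss for \<open>\<gamma>\<close> times the
  loss at half the difference, which is at most the modulus at radius \<open>t\<close>. The choice of \<open>\<tau>\<close>
  that makes the radius equal to \<open>t\<close> has \<open>\<tau>\<^sup>2 = n * (\<delta> * t)\<^sup>2 / 2\<close>, a quarter of the
  Hoeffding exponent, and so the test does at least as well as claimed. When \<open>\<epsilon> = 0\<close> we have
  \<open>\<delta> = 0\<close>, so \<open>\<tau> = 0\<close>, the error bound is the trivial 1, and the infinite radius admits
  every \<open>P1\<close>.
\<close>

section \<open>The law of the privatised sample\<close>

lemma emeasure_product_kernel:
  assumes "finite I" and Q: "Q \<in> X \<rightarrow>\<^sub>M prob_algebra Z"
    and x: "x \<in> space (Pi\<^sub>M I (\<lambda>_. X))" and B: "\<And>i. i \<in> I \<Longrightarrow> B i \<in> sets Z"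
  shows "emeasure (Pi\<^sub>M I (\<lambda>i. Q (x i))) (Pi\<^sub>E I B) = (\<Prod>i\<in>I. emeasure (Q (x i)) (B i))"
proof -
  have "Q (x i) \<in> space (prob_algebra Z)" if "i \<in> I" for i
    using x that by (intro measurable_space[OF Q]) (auto simp: space_PiM)
  then have prob: "prob_space (Q (x i))" and B': "B i \<in> sets (Q (x i))" if "i \<in> I" for i
    using that B by (auto simp: space_prob_algebra)
  have "emeasure (Pi\<^sub>M I (\<lambda>i. Q (x i))) (prod_emb I (\<lambda>i. Q (x i)) I (Pi\<^sub>E I B))
      = (\<Prod>i\<in>I. emeasure (Q (x i)) (B i))"
    using prob B' \<open>finite I\<close> by (intro emeasure_PiM_emb) auto
  then show ?thesis
    by (subst (asm) prod_emb_PiE_same_index[OF sets.sets_into_space[OF B']])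
qed

text \<open>Rectangles generate the product sigma-algebra and are stable under intersection, so
  measurability of the kernel only has to be checked on them.\<close>

lemma measurable_product_kernel:
  assumes "finite I" and Q: "Q \<in> X \<rightarrow>\<^sub>M prob_algebra Z"
  shows "(\<lambda>x. Pi\<^sub>M I (\<lambda>i. Q (x i))) \<in> Pi\<^sub>M I (\<lambda>_. X) \<rightarrow>\<^sub>M prob_algebra (Pi\<^sub>M I (\<lambda>_. Z))"
proof (rule measurable_prob_algebra_generated[OF sets_PiM Int_stable_prod_algebra
      prod_algebra_sets_into_space])
  fix x assume x: "x \<in> space (Pi\<^sub>M I (\<lambda>_. X))"
  have Qx: "Q (x i) \<in> space (prob_algebra Z)" if "i \<in> I" for i
    using x that by (intro measurable_space[OF Q]) (auto simp: space_PiM)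
  show "prob_space (Pi\<^sub>M I (\<lambda>i. Q (x i)))"
    using Qx by (intro prob_space_PiM) (simp add: space_prob_algebra)
  show "sets (Pi\<^sub>M I (\<lambda>i. Q (x i))) = sets (Pi\<^sub>M I (\<lambda>_. Z))"
    using Qx by (intro sets_PiM_cong) (auto simp: space_prob_algebra)
next
  fix A assume "A \<in> prod_algebra I (\<lambda>_. Z)"
  then obtain B where A: "A = Pi\<^sub>E I B" and B: "\<And>i. i \<in> I \<Longrightarrow> B i \<in> sets Z"
    by (elim prod_algebraE_all) auto
  have "(\<lambda>x. \<Prod>i\<in>I. emeasure (Q (x i)) (B i)) \<in> borel_measurable (Pi\<^sub>M I (\<lambda>_. X))"
    using Q B by (intro borel_measurable_prod_ennreal measurable_emeasure_kernel[of Q X Z]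
        measurable_compose[OF measurable_component_singleton]) (auto dest: measurable_prob_algebraD)
  then show "(\<lambda>x. emeasure (Pi\<^sub>M I (\<lambda>i. Q (x i))) A) \<in> borel_measurable (Pi\<^sub>M I (\<lambda>_. X))"
    using B by (subst measurable_cong) (auto simp: A emeasure_product_kernel[OF assms])
qed

text \<open>Given the data, the reports are independent, and report \<open>i\<close> depends on the data only
  through coordinate \<open>i\<close>. So averaging the probability of a rectangle over i.i.d. data factorises,
  by Tonelli, into the probabilities of its sides under the one-sample output law.\<close>

lemma private_law_eq_PiM:
  assumes Q: "Q \<in> X \<rightarrow>\<^sub>M prob_algebra Z" and P: "P \<in> space (prob_algebra X)"
  shows "private_law n Q P = Pi\<^sub>M {..<n} (\<lambda>_. P \<bind> Q)"
proof -
  let ?I = "{..<n}"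
  have setsP: "sets P = sets X" and "prob_space P"
    using P by (auto simp: space_prob_algebra)
  interpret P: prob_space P by fact
  interpret PP: product_prob_space "\<lambda>_::nat. P" ..
  interpret G: prob_space "P \<bind> Q" using P Q by (rule prob_space_bind')
  interpret GG: product_prob_space "\<lambda>_::nat. P \<bind> Q" ..
  have setsG: "sets (P \<bind> Q) = sets Z" using P Q by (rule sets_bind')
  have setsPI: "sets (Pi\<^sub>M ?I (\<lambda>_. P)) = sets (Pi\<^sub>M ?I (\<lambda>_. X))"
    using setsP by (intro sets_PiM_cong) auto
  have PI: "Pi\<^sub>M ?I (\<lambda>_. P) \<in> space (prob_algebra (Pi\<^sub>M ?I (\<lambda>_. X)))"
    using setsPI prob_space_PiM[of ?I "\<lambda>_. P"] P.prob_space_axioms by (simp add: space_prob_algebra)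
  note K = measurable_product_kernel[OF finite_lessThan[of n] Q]
  show ?thesis
    unfolding private_law_def
  proof (rule GG.PiM_eqI)
    show "sets (Pi\<^sub>M ?I (\<lambda>_. P) \<bind> (\<lambda>x. Pi\<^sub>M ?I (\<lambda>i. Q (x i)))) = sets (Pi\<^sub>M ?I (\<lambda>_. P \<bind> Q))"
      using sets_bind'[OF PI K] sets_PiM_cong[of ?I ?I "\<lambda>_. P \<bind> Q" "\<lambda>_. Z"] setsG by simp
  next
    fix B :: "nat \<Rightarrow> _ set" assume "\<And>i. i \<in> ?I \<Longrightarrow> B i \<in> sets (P \<bind> Q)"
    then have B: "\<And>i. i \<in> ?I \<Longrightarrow> B i \<in> sets Z" by (simp add: setsG)
    have "emeasure (Pi\<^sub>M ?I (\<lambda>_. P) \<bind> (\<lambda>x. Pi\<^sub>M ?I (\<lambda>i. Q (x i)))) (Pi\<^sub>E ?I B)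
        = (\<integral>\<^sup>+x. emeasure (Pi\<^sub>M ?I (\<lambda>i. Q (x i))) (Pi\<^sub>E ?I B) \<partial>Pi\<^sub>M ?I (\<lambda>_. P))"
      using B by (intro emeasure_bind_prob_algebra[OF PI K]) auto
    also have "\<dots> = (\<integral>\<^sup>+x. (\<Prod>i\<in>?I. emeasure (Q (x i)) (B i)) \<partial>Pi\<^sub>M ?I (\<lambda>_. P))"
      using B sets_eq_imp_space_eq[OF setsPI]
      by (intro nn_integral_cong emeasure_product_kernel[OF finite_lessThan Q]) auto
    also have "\<dots> = (\<Prod>i\<in>?I. \<integral>\<^sup>+x. emeasure (Q x) (B i) \<partial>P)"
      using Q B setsP by (intro PP.product_nn_integral_prod)
        (auto intro!: measurable_emeasure_kernel[of Q X Z] dest: measurable_prob_algebraD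
          simp: measurable_cong_sets[OF setsP refl])
    also have "\<dots> = (\<Prod>i\<in>?I. emeasure (P \<bind> Q) (B i))"
      using B by (intro prod.cong refl emeasure_bind_prob_algebra[OF P Q, symmetric]) auto
    finally show "emeasure (Pi\<^sub>M ?I (\<lambda>_. P) \<bind> (\<lambda>x. Pi\<^sub>M ?I (\<lambda>i. Q (x i)))) (Pi\<^sub>E ?I B)
        = (\<Prod>i\<in>?I. emeasure (P \<bind> Q) (B i))" .
  qed simp
qed

section \<open>Deviations of an empirical frequency\<close>

text \<open>Under a power of \<open>G\<close> the coordinates are i.i.d. with law \<open>G\<close>, and the indicator of \<open>B\<close>
  takes values in \<open>[0, 1]\<close> and has mean \<open>measure G B\<close>, so Hoeffding's inequality applies to the
  empirical frequency of \<open>B\<close>.\<close>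

lemma
  fixes n :: nat and t :: real
  assumes "prob_space G" and B [measurable]: "B \<in> sets G" and n: "0 < n" and t: "0 \<le> t"
  defines "GG \<equiv> Pi\<^sub>M {..<n} (\<lambda>_. G)"
  shows Hoeffding_frequency_ge: "measure GG {z\<in>space GG.
      measure G B + t \<le> (\<Sum>i<n. indicator B (z i)) / real n} \<le> exp (- 2 * real n * t\<^sup>2)" (is ?ge)
    and Hoeffding_frequency_le: "measure GG {z\<in>space GG.
      (\<Sum>i<n. indicator B (z i)) / real n \<le> measure G B - t} \<le> exp (- 2 * real n * t\<^sup>2)" (is ?le)
proof -
  interpret G: prob_space G by fact
  interpret GG: prob_space GG
    unfolding GG_def by (intro prob_space_PiM) (rule assms)
  have coord [measurable]: "(\<lambda>z. z i) \<in> GG \<rightarrow>\<^sub>M G" if "i < n" for i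
    using that unfolding GG_def by simp
  have distr_coord: "distr GG G (\<lambda>z. z i) = G" if "i < n" for i
    using that \<open>prob_space G\<close> unfolding GG_def by (intro distr_PiM_component) auto
  have indep: "GG.indep_vars (\<lambda>_. G) (\<lambda>i z. z i) {..<n}"
  proof (subst GG.indep_vars_iff_distr_eq_PiM')
    have "distr GG (Pi\<^sub>M {..<n} (\<lambda>_. G)) (\<lambda>z. \<lambda>i\<in>{..<n}. z i) = distr GG GG (\<lambda>z. z)"
      unfolding GG_def by (intro distr_cong refl) (auto simp: space_PiM)
    also have "\<dots> = Pi\<^sub>M {..<n} (\<lambda>i. distr GG G (\<lambda>z. z i))"
      unfolding distr_id using distr_coord by (subst GG_def) (intro PiM_cong, auto)
    finally show "distr GG (Pi\<^sub>M {..<n} (\<lambda>_. G)) (\<lambda>z. \<lambda>i\<in>{..<n}. z i)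
        = Pi\<^sub>M {..<n} (\<lambda>i. distr GG G (\<lambda>z. z i))" .
  qed (use n coord in auto)
  have distr_indicator: "distr GG borel (\<lambda>z. indicator B (z i) :: real) = distr G borel (indicator B)"
    if "i < n" for i
    using distr_distr[of "indicator B :: _ \<Rightarrow> real" G borel "\<lambda>z. z i" GG] distr_coord[OF that] coord[OF that]
    by (simp add: comp_def)
  have "GG.expectation (\<lambda>z. indicator B (z 0) :: real) = G.expectation (indicator B)"
    using integral_distr[OF coord[OF n], of "indicator B :: _ \<Rightarrow> real"] distr_coord[OF n] by simp
  then have mean: "measure G B \<equiv> GG.expectation (\<lambda>z. indicator B (z 0))"
    by (simp add: Int_absorb2 sets.sets_into_space)
  interpret Hoeffding_ineq_iid GG "{..<n}" "\<lambda>i z. indicator B (z i)" "\<lambda>z. indicator B (z 0)" 0 1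
    "measure G B"
  proof unfold_locales
    show "GG.indep_vars (\<lambda>_. borel) (\<lambda>i z. indicator B (z i)) {..<n}"
      by (rule GG.indep_vars_compose2[OF indep]) auto
    show "distr GG borel (\<lambda>z. indicator B (z i)) = distr GG borel (\<lambda>z. indicator B (z 0) :: real)"
      if "i \<in> {..<n}" for i
      using that n by (simp add: distr_indicator)
    show "(\<lambda>z. indicator B (z 0) :: real) \<in> borel_measurable GG"
      by (rule measurable_compose[OF coord[OF n]]) auto
    show "AE z in GG. indicator B (z 0) \<in> {0..1::real}"
      by (auto simp: indicator_def)
    show "measure G B \<equiv> GG.expectation (\<lambda>z. indicator B (z 0))" by (rule mean)
  qed simp
  show ?ge using Hoeffding_ineq_ge'[OF t] n by (simp add: lessThan_empty_iff)
  show ?le using Hoeffding_ineq_le'[OF t] n by (simp add: lessThan_empty_iff)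
qed


section \<open>Total variation distance\<close>

text \<open>The positive part \<open>A\<close> of a Hahn decomposition of \<open>P - P'\<close> maximises \<open>P B - P' B\<close>: passing
  from \<open>B\<close> to \<open>A\<close> drops \<open>B - A\<close>, where the difference is at most 0, and adds \<open>A - B\<close>, where it is at
  least 0. For probability measures complements change the sign of the difference, so the same \<open>A\<close>
  also maximises its absolute value. No absolute value is left in the conclusion, which fixes the
  direction of the test.\<close>

lemma tv_dist_attained:
  assumes P: "P \<in> space (prob_algebra X)" and P': "P' \<in> space (prob_algebra X)"
  shows "\<exists>A\<in>sets X. measure P A - measure P' A = tv_dist P P'"
proof -
  have sets: "sets P = sets X" "sets P' = sets X" and "prob_space P" "prob_space P'"
    using P P' by (auto simp: space_prob_algebra)
  interpret P: prob_space P by fact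
  interpret P': prob_space P' by fact
  obtain A where A: "A \<in> sets P"
    and A_le: "\<And>B. B \<in> sets P \<Longrightarrow> B \<subseteq> A \<Longrightarrow> emeasure P' B \<le> emeasure P B"
    and A_ge: "\<And>B. B \<in> sets P \<Longrightarrow> B \<inter> A = {} \<Longrightarrow> emeasure P B \<le> emeasure P' B"
    using finite_unsigned_Hahn_decomposition[of P P'] sets P.finite_measure_axioms
      P'.finite_measure_axioms by auto
  let ?d = "\<lambda>B. measure P B - measure P' B"
  have le: "?d B \<le> ?d A" if B: "B \<in> sets P" for B
  proof -
    have diff: "measure M (B - A) = measure M B - measure M (B \<inter> A)"
      "measure M (A - B) = measure M A - measure M (B \<inter> A)"
      if "finite_measure M" "sets M = sets P" for M
      using that A B finite_measure.finite_measure_Diff'[of M B A]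
        finite_measure.finite_measure_Diff'[of M A B] by (auto simp: Int_commute)
    have "measure P (B - A) \<le> measure P' (B - A)"
      using A_ge[of "B - A"] A B by (auto simp: P.emeasure_eq_measure P'.emeasure_eq_measure)
    moreover have "measure P' (A - B) \<le> measure P (A - B)"
      using A_le[of "A - B"] A B by (auto simp: P.emeasure_eq_measure P'.emeasure_eq_measure)
    ultimately show ?thesis
      using diff[of P] diff[of P'] P.finite_measure_axioms P'.finite_measure_axioms sets by simp
  qed
  have bound: "\<bar>?d B\<bar> \<le> ?d A" if B: "B \<in> sets P" for B
  proof -
    have "?d (space P - B) = - ?d B"
      using P.prob_compl[of B] P'.prob_compl[of B] B sets sets_eq_imp_space_eq[of P P'] by simp
    then show ?thesis
      using le[OF B] le[of "space P - B"] B by auto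
  qed
  have "tv_dist P P' = ?d A"
    unfolding tv_dist_def
  proof (rule antisym)
    show "(SUP B\<in>sets P. \<bar>?d B\<bar>) \<le> ?d A"
      using bound by (intro cSUP_least) auto
    have "bdd_above ((\<lambda>B. \<bar>?d B\<bar>) ` sets P)"
      using bound by (intro bdd_aboveI2)
    then have "\<bar>?d A\<bar> \<le> (SUP B\<in>sets P. \<bar>?d B\<bar>)"
      using A by (intro cSUP_upper)
    then show "?d A \<le> (SUP B\<in>sets P. \<bar>?d B\<bar>)" by simp
  qed
  then show ?thesis
    using A sets by auto
qed

lemma tv_dist_nonneg:
  assumes "P \<in> space (prob_algebra X)" "P' \<in> space (prob_algebra X)"
  shows "0 \<le> tv_dist P P'"
proof -
  have "prob_space P" "prob_space P'"
    using assms by (auto simp: space_prob_algebra)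
  then have "bdd_above ((\<lambda>A. \<bar>measure P A - measure P' A\<bar>) ` sets P)"
    by (intro bdd_aboveI2[where M = 1])
      (smt (verit) prob_space.prob_le_1 measure_nonneg)
  then show ?thesis
    unfolding tv_dist_def by (rule cSUP_upper2[where x = "{}"]) auto
qed

section \<open>Randomized response\<close>

lemma privacy_delta_nonneg: "0 \<le> \<epsilon> \<Longrightarrow> 0 \<le> privacy_delta \<epsilon>"
  by (simp add: privacy_delta_def field_simps add_pos_pos)

text \<open>The letter \<open>a\<close> reports \<open>x \<in> A\<close> and the letter \<open>b\<close> reports \<open>x \<notin> A\<close>. The report is truthful
  with probability \<open>1/2 + privacy_delta \<epsilon>\<close>.\<close>

definition randomized_response :: "real \<Rightarrow> 'x set \<Rightarrow> 'z \<Rightarrow> 'z \<Rightarrow> 'x \<Rightarrow> 'z measure" where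
  "randomized_response \<epsilon> A a b x =
     measure_pmf (map_pmf (\<lambda>truthful. if truthful \<longleftrightarrow> x \<in> A then a else b)
       (bernoulli_pmf (exp \<epsilon> / (exp \<epsilon> + 1))))"

lemma measure_randomized_response:
  "measure (randomized_response \<epsilon> A a b x) B =
     (if x \<in> A then exp \<epsilon> * indicator B a + indicator B b
      else exp \<epsilon> * indicator B b + indicator B a) / (exp \<epsilon> + 1)"
proof -
  have pos: "0 < exp \<epsilon> + 1" by (simp add: add_pos_pos)
  let ?p = "exp \<epsilon> / (exp \<epsilon> + 1)"
  let ?f = "\<lambda>truthful. if truthful \<longleftrightarrow> x \<in> A then a else b"
  have p: "0 \<le> ?p" "?p \<le> 1" "1 - ?p = 1 / (exp \<epsilon> + 1)"
    using pos by (auto simp: field_simps)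
  have "measure (randomized_response \<epsilon> A a b x) B
      = measure_pmf.expectation (bernoulli_pmf ?p) (indicator (?f -` B))"
    by (simp add: randomized_response_def)
  also have "\<dots> = ?p * indicator B (?f True) + 1 / (exp \<epsilon> + 1) * indicator B (?f False)"
    using p by (subst integral_bernoulli_pmf) (auto simp: indicator_def)
  finally show ?thesis
    by (simp add: add_divide_distrib)
qed

text \<open>The odds of a truthful report are exactly \<open>exp \<epsilon>\<close>, so a change of input changes the
  probability of either letter by at most that factor. The kernel sees \<open>x\<close> only through
  \<open>x \<in> A\<close>, which makes it measurable.\<close>

lemma randomized_response_private:
  assumes "A \<in> sets X" "0 \<le> \<epsilon>"
  shows "(count_space UNIV, randomized_response \<epsilon> A a b) \<in> private_channels \<epsilon> X"
  unfolding private_channels_def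
proof (intro CollectI case_prodI conjI ballI)
  let ?law = "\<lambda>c. measure_pmf (map_pmf (\<lambda>truthful. if truthful \<longleftrightarrow> c then a else b)
       (bernoulli_pmf (exp \<epsilon> / (exp \<epsilon> + 1))))"
  have "(\<lambda>x. x \<in> A) \<in> X \<rightarrow>\<^sub>M count_space UNIV"
    using assms(1) by measurable
  moreover have "?law \<in> count_space UNIV \<rightarrow>\<^sub>M prob_algebra (count_space UNIV)"
    by (auto simp: space_prob_algebra measure_pmf.prob_space_axioms)
  ultimately show "randomized_response \<epsilon> A a b \<in> X \<rightarrow>\<^sub>M prob_algebra (count_space UNIV)"
    unfolding randomized_response_def by (rule measurable_compose)
next
  fix x x' and B :: "'b set"
  define e where "e = exp \<epsilon>"
  have e: "1 \<le> e" "e \<le> e * e" "1 \<le> e * e"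
    using \<open>0 \<le> \<epsilon>\<close> by (auto simp: e_def simp flip: exp_add)
  show "measure (randomized_response \<epsilon> A a b x) B \<le> exp \<epsilon> * measure (randomized_response \<epsilon> A a b x') B"
    unfolding measure_randomized_response e_def[symmetric] times_divide_eq_right
    by (rule divide_right_mono) (use e in \<open>auto simp: indicator_def ring_distribs\<close>)
qed

text \<open>The channel contracts the difference of two probabilities of \<open>A\<close> by the factor
  \<open>2 * privacy_delta \<epsilon>\<close>; this is the price of privacy.\<close>

lemma measure_bind_randomized_response:
  assumes P: "P \<in> space (prob_algebra X)" and A: "A \<in> sets X" and "a \<noteq> b" "0 \<le> \<epsilon>"
  shows "measure (P \<bind> randomized_response \<epsilon> A a b) {a} =
    1/2 - privacy_delta \<epsilon> + 2 * privacy_delta \<epsilon> * measure P A"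
proof -
  let ?Q = "randomized_response \<epsilon> A a b" and ?e = "exp \<epsilon>"
  have sets: "sets P = sets X" and "prob_space P"
    using P by (auto simp: space_prob_algebra)
  interpret P: prob_space P by fact
  have pos: "0 < ?e + 1" by (simp add: add_pos_pos)
  have Q: "?Q \<in> X \<rightarrow>\<^sub>M prob_algebra (count_space UNIV)"
    using randomized_response_private[OF A \<open>0 \<le> \<epsilon>\<close>, of a b] by (simp add: private_channels_def)
  have "measure (P \<bind> ?Q) {a} = (\<integral>x. measure (?Q x) {a} \<partial>P)"
    using Q sets by (intro P.measure_bind[where N = "count_space UNIV"])
      (auto dest: measurable_prob_algebraD simp: measurable_cong_sets[OF sets refl])
  also have "\<dots> = (\<integral>x. 1 / (?e + 1) + (?e - 1) / (?e + 1) * indicator A x \<partial>P)"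
    using \<open>a \<noteq> b\<close> pos by (intro Bochner_Integration.integral_cong refl)
      (auto simp: measure_randomized_response field_simps)
  also have "\<dots> = 1 / (?e + 1) + (?e - 1) / (?e + 1) * measure P A"
    using A sets by (subst Bochner_Integration.integral_add)
      (auto simp: P.prob_space Int_absorb2 sets.sets_into_space P.emeasure_eq_measure
        intro!: integrable_real_indicator)
  also have "\<dots> = 1/2 - privacy_delta \<epsilon> + 2 * privacy_delta \<epsilon> * measure P A"
  proof -
    have "1 / (?e + 1) = 1/2 - privacy_delta \<epsilon>" "(?e - 1) / (?e + 1) = 2 * privacy_delta \<epsilon>"
      using pos by (simp_all add: privacy_delta_def field_simps)
    then show ?thesis by simp
  qed
  finally show ?thesis .
qed


section \<open>Risk of the private two-point test\<close>

lemma loss_modulus_ge: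
  assumes "P \<in> \<P>" "ereal (tv_dist P P0) \<le> r"
  shows "ennreal (L ((1/2) *\<^sub>R (\<theta> P0 - \<theta> P))) \<le> loss_modulus L \<theta> r P0 \<P>"
  using assms unfolding loss_modulus_def by (intro SUP_upper) auto

text \<open>The estimator takes only the values \<open>\<theta> P0\<close> and \<open>\<theta> P1\<close>, so its risk under either
  distribution is the loss of the wrong answer times the probability of giving it. Finitely many
  values also make the estimator and all its losses measurable, even when \<open>L\<close> is not.\<close>

lemma two_point_risk_le:
  fixes L :: "'a::euclidean_space \<Rightarrow> real" and a b :: 'z and n :: nat and \<epsilon> :: real
  assumes nonneg: "\<And>t. 0 \<le> L t" and sym: "\<And>t. L (- t) = L t" and zero: "L 0 = 0"
    and \<P>: "\<P> \<subseteq> space (prob_algebra X)" and \<theta>: "\<theta> \<in> \<P> \<rightarrow> \<Theta>"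
    and P0: "P0 \<in> \<P>" and P1: "P1 \<in> \<P>" and \<epsilon>: "0 \<le> \<epsilon>" and n: "0 < n" and ab: "a \<noteq> b"
  defines "bound \<equiv> ennreal (L (\<theta> P0 - \<theta> P1) * exp (- 2 * real n * (privacy_delta \<epsilon> * tv_dist P1 P0)\<^sup>2))"
  shows "\<exists>A T. A \<in> sets X \<and> T \<in> estimators n (count_space UNIV :: 'z measure) L \<theta> \<Theta> \<P> \<and>
    risk n L \<theta> (randomized_response \<epsilon> A a b) T P0 \<le> bound \<and>
    risk n L \<theta> (randomized_response \<epsilon> A a b) T P1 \<le> bound"
proof -
  have P: "P0 \<in> space (prob_algebra X)" "P1 \<in> space (prob_algebra X)"
    using \<P> P0 P1 by auto
  obtain A where A: "A \<in> sets X" and tv: "measure P1 A - measure P0 A = tv_dist P1 P0"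
    using tv_dist_attained[OF P(2,1)] by auto
  let ?Q = "randomized_response \<epsilon> A a b" and ?Z = "count_space UNIV :: 'z measure"
  let ?law = "\<lambda>P. Pi\<^sub>M {..<n} (\<lambda>_. P \<bind> ?Q)"
  define q where "q P = measure (P \<bind> ?Q) {a}" for P
  define m where "m = privacy_delta \<epsilon> * tv_dist P1 P0"
  \<comment> \<open>\<open>m\<close> is half the gap between the two probabilities of a positive report, so the test below
    has its threshold at their midpoint \<open>q P0 + m = q P1 - m\<close>.\<close>
  have m: "0 \<le> m"
    using tv_dist_nonneg[OF P(2,1)] privacy_delta_nonneg[OF \<epsilon>] by (simp add: m_def)
  have q: "q P1 = q P0 + 2 * m"
    using measure_bind_randomized_response[OF _ A ab \<epsilon>] P
    by (simp add: q_def m_def flip: tv) (simp add: algebra_simps)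
  define freq where "freq z = (\<Sum>i<n. indicator {a} (z i)) / real n" for z :: "nat \<Rightarrow> 'z"
  define T where "T z = (if q P0 + m \<le> freq z then \<theta> P1 else \<theta> P0)" for z
  have freq [measurable]: "freq \<in> borel_measurable (Pi\<^sub>M {..<n} (\<lambda>_. ?Z))"
    unfolding freq_def
    by (intro borel_measurable_divide borel_measurable_sum borel_measurable_const
        measurable_compose[OF measurable_component_singleton]) auto
  have T: "T \<in> estimators n ?Z L \<theta> \<Theta> \<P>"
    unfolding estimators_def
  proof (intro CollectI conjI ballI)
    show "T \<in> Pi\<^sub>M {..<n} (\<lambda>_. ?Z) \<rightarrow>\<^sub>M restrict_space borel \<Theta>"
      unfolding T_def using \<theta> P0 P1
      by (intro measurable_If measurable_const) (auto simp: space_restrict_space)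
    show "(\<lambda>z. L (T z - \<theta> P)) \<in> borel_measurable (Pi\<^sub>M {..<n} (\<lambda>_. ?Z))" for P
      unfolding T_def if_distrib[of "\<lambda>t. L (t - \<theta> P)"] by measurable
  qed
  have law: "private_law n ?Q P = ?law P"
    and prob: "prob_space (P \<bind> ?Q)" and sets: "sets (P \<bind> ?Q) = UNIV"
    and sets_law: "sets (?law P) = sets (Pi\<^sub>M {..<n} (\<lambda>_. ?Z))"
    if "P \<in> space (prob_algebra X)" for P
  proof -
    have Q: "?Q \<in> X \<rightarrow>\<^sub>M prob_algebra ?Z"
      using randomized_response_private[OF A \<epsilon>, of a b] by (simp add: private_channels_def)
    show "private_law n ?Q P = ?law P" using Q that by (rule private_law_eq_PiM)
    show "prob_space (P \<bind> ?Q)" using that Q by (rule prob_space_bind')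
    show "sets (P \<bind> ?Q) = UNIV" using sets_bind'[OF that Q] by simp
    then show "sets (?law P) = sets (Pi\<^sub>M {..<n} (\<lambda>_. ?Z))"
      by (intro sets_PiM_cong) auto
  qed
  \<comment> \<open>The predicate \<open>err\<close> describes the samples on which the test decides against \<open>P\<close>.\<close>
  have risk_le: "risk n L \<theta> ?Q T P \<le> bound"
    if P: "P \<in> space (prob_algebra X)" and pred: "Measurable.pred (Pi\<^sub>M {..<n} (\<lambda>_. ?Z)) err"
      and err: "\<And>z. L (T z - \<theta> P) = (if err z then L (\<theta> P0 - \<theta> P1) else 0)"
      and small: "measure (?law P) {z\<in>space (?law P). err z} \<le> exp (- 2 * real n * m\<^sup>2)" for P err
  proof -
    interpret law: prob_space "?law P"
      using prob[OF P] by (intro prob_space_PiM)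
    have meas: "{z\<in>space (?law P). err z} \<in> sets (?law P)"
      using pred by (simp add: pred_def sets_law[OF P] sets_eq_imp_space_eq[OF sets_law[OF P]])
    have "risk n L \<theta> ?Q T P
        = (\<integral>\<^sup>+z. ennreal (L (\<theta> P0 - \<theta> P1)) * indicator {z\<in>space (?law P). err z} z \<partial>?law P)"
      unfolding risk_def law[OF P] by (intro nn_integral_cong) (auto simp: err)
    also have "\<dots> = ennreal (L (\<theta> P0 - \<theta> P1)) * emeasure (?law P) {z\<in>space (?law P). err z}"
      using meas by (rule nn_integral_cmult_indicator)
    also have "\<dots> \<le> bound"
      unfolding bound_def m_def[symmetric] law.emeasure_eq_measure ennreal_mult'[OF nonneg]
      using small by (intro mult_left_mono ennreal_leI) auto
    finally show ?thesis .
  qed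
  have "risk n L \<theta> ?Q T P0 \<le> bound"
  proof (rule risk_le)
    show "measure (?law P0) {z\<in>space (?law P0). q P0 + m \<le> freq z} \<le> exp (- 2 * real n * m\<^sup>2)"
      unfolding q_def freq_def
      using prob sets P n m by (intro Hoeffding_frequency_ge) auto
    show "L (T z - \<theta> P0) = (if q P0 + m \<le> freq z then L (\<theta> P0 - \<theta> P1) else 0)" for z
      using sym[of "\<theta> P0 - \<theta> P1"] by (simp add: T_def zero)
  qed (use P in auto)
  moreover have "risk n L \<theta> ?Q T P1 \<le> bound"
  proof (rule risk_le)
    interpret law: prob_space "?law P1"
      using prob[OF P(2)] by (intro prob_space_PiM)
    have "measure (?law P1) {z\<in>space (?law P1). \<not> q P0 + m \<le> freq z}
        \<le> measure (?law P1) {z\<in>space (?law P1). freq z \<le> q P1 - m}"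
    proof (rule law.finite_measure_mono)
      show "{z\<in>space (?law P1). freq z \<le> q P1 - m} \<in> sets (?law P1)"
        unfolding sets_eq_imp_space_eq[OF sets_law[OF P(2)]] sets_law[OF P(2)] by measurable
    qed (use q in auto)
    also have "\<dots> \<le> exp (- 2 * real n * m\<^sup>2)"
      unfolding q_def freq_def
      using prob sets P n m by (intro Hoeffding_frequency_le) auto
    finally show "measure (?law P1) {z\<in>space (?law P1). \<not> q P0 + m \<le> freq z}
      \<le> exp (- 2 * real n * m\<^sup>2)" .
    show "L (T z - \<theta> P1) = (if \<not> q P0 + m \<le> freq z then L (\<theta> P0 - \<theta> P1) else 0)" for z
      by (simp add: T_def zero)
  qed (use P in auto)
  ultimately show ?thesis
    using A T by blast
qed

theorem proposition2:
  fixes L :: "real ^ 'd \<Rightarrow> real" and \<gamma> \<epsilon> :: real and n :: nat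
    and X :: "'x measure" and \<P> :: "'x measure set" and P0 :: "'x measure"
    and \<theta> :: "'x measure \<Rightarrow> real ^ 'd" and \<Theta> :: "(real ^ 'd) set"
  assumes "\<And>t. 0 \<le> L t"
    and "\<And>t. L (- t) = L t"
    and "quasiconvex L"
    and "L 0 = 0"
    and "\<And>t. L t \<le> \<gamma> * L ((1/2) *\<^sub>R t)"
    and "\<P> \<subseteq> space (prob_algebra X)"
    and "\<theta> \<in> \<P> \<rightarrow> \<Theta>"
    and "P0 \<in> \<P>"
    and "0 \<le> \<epsilon>"
    and "1 \<le> n"
    and "\<exists>z z' :: 'z. z \<noteq> z'"
  shows "local_minimax_risk n P0 L \<theta> \<Theta> \<P>
           (private_channels \<epsilon> X :: ('z measure \<times> ('x \<Rightarrow> 'z measure)) set)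
         \<le> 2 * ennreal \<gamma> *
           (SUP \<tau>\<in>{0..}. loss_modulus L \<theta> (privacy_radius \<epsilon> n \<tau>) P0 \<P> * ennreal (exp (- \<tau>\<^sup>2)))"
  unfolding local_minimax_risk_def
proof (rule SUP_least)
  fix P1 assume P1: "P1 \<in> \<P>"
  let ?\<omega> = "\<lambda>\<tau>. loss_modulus L \<theta> (privacy_radius \<epsilon> n \<tau>) P0 \<P> * ennreal (exp (- \<tau>\<^sup>2))"
  let ?\<Q> = "private_channels \<epsilon> X :: ('z measure \<times> ('x \<Rightarrow> 'z measure)) set"
  define \<delta> where "\<delta> = privacy_delta \<epsilon>"
  define t where "t = tv_dist P1 P0"
  \<comment> \<open>This makes the radius equal to \<open>t\<close> if \<open>\<epsilon> > 0\<close>, and is 0 if \<open>\<epsilon> = 0\<close>.\<close>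
  define \<tau> where "\<tau> = \<delta> * t * sqrt (real n) / sqrt 2"
  define bound where "bound = ennreal (L (\<theta> P0 - \<theta> P1) * exp (- 2 * real n * (\<delta> * t)\<^sup>2))"
  obtain a b :: 'z where ab: "a \<noteq> b" using assms(11) by auto
  have n: "0 < n" using assms(10) by simp
  obtain A T where A: "A \<in> sets X"
    and T: "T \<in> estimators n (count_space UNIV :: 'z measure) L \<theta> \<Theta> \<P>"
    and risk: "risk n L \<theta> (randomized_response \<epsilon> A a b) T P0 \<le> bound"
      "risk n L \<theta> (randomized_response \<epsilon> A a b) T P1 \<le> bound"
    using two_point_risk_le[OF assms(1,2,4,6-8) P1 assms(9) n ab]
    unfolding bound_def \<delta>_def t_def by metis
  have "(INF (Z, Q)\<in>?\<Q>. INF T\<in>estimators n Z L \<theta> \<Theta> \<P>. MAX P\<in>{P0, P1}. risk n L \<theta> Q T P)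
      \<le> (INF T\<in>estimators n (count_space UNIV) L \<theta> \<Theta> \<P>.
           MAX P\<in>{P0, P1}. risk n L \<theta> (randomized_response \<epsilon> A a b) T P)"
    by (rule INF_lower2[OF randomized_response_private[OF A assms(9), of a b]]) simp
  also have "\<dots> \<le> (MAX P\<in>{P0, P1}. risk n L \<theta> (randomized_response \<epsilon> A a b) T P)"
    using T by (rule INF_lower)
  also have "\<dots> \<le> bound"
    using risk by simp
  also have "bound \<le> 2 * ennreal \<gamma> * (SUP \<tau>\<in>{0..}. ?\<omega> \<tau>)"
  proof -
    have "0 \<le> t" "0 \<le> \<delta>"
      using tv_dist_nonneg[of P1 X P0] privacy_delta_nonneg[OF assms(9)] assms(6,8) P1
      by (auto simp: \<delta>_def t_def)
    then have "0 \<le> \<tau>" by (simp add: \<tau>_def)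
    have \<delta>_pos: "0 < \<delta>" if "\<epsilon> \<noteq> 0"
      using assms(9) that by (simp add: \<delta>_def privacy_delta_def field_simps add_pos_pos)
    have "L (\<theta> P0 - \<theta> P1) * exp (- 2 * real n * (\<delta> * t)\<^sup>2)
        \<le> \<gamma> * L ((1/2) *\<^sub>R (\<theta> P0 - \<theta> P1)) * exp (- \<tau>\<^sup>2)"
    proof (rule mult_mono)
      have "\<tau>\<^sup>2 = real n * (\<delta> * t)\<^sup>2 / 2"
        by (simp add: \<tau>_def power_divide power_mult_distrib)
      moreover have "0 \<le> real n * (\<delta> * t)\<^sup>2" by simp
      ultimately show "exp (- 2 * real n * (\<delta> * t)\<^sup>2) \<le> exp (- \<tau>\<^sup>2)"
        by (simp only: exp_le_cancel_iff mult.assoc)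
    qed (use assms(1,5) order_trans[OF assms(1,5)] in auto)
    then have "bound \<le> ennreal (\<gamma> * L ((1/2) *\<^sub>R (\<theta> P0 - \<theta> P1)) * exp (- \<tau>\<^sup>2))"
      unfolding bound_def by (rule ennreal_leI)
    also have "\<dots> = ennreal \<gamma> * (ennreal (L ((1/2) *\<^sub>R (\<theta> P0 - \<theta> P1))) * ennreal (exp (- \<tau>\<^sup>2)))"
      using assms(1) by (simp add: ennreal_mult'' mult.assoc)
    also have "\<dots> \<le> ennreal \<gamma> * ?\<omega> \<tau>"
    proof (intro mult_left_mono mult_right_mono loss_modulus_ge P1)
      show "ereal (tv_dist P1 P0) \<le> privacy_radius \<epsilon> n \<tau>"
        using \<delta>_pos n by (cases "\<epsilon> = 0") (simp_all add: privacy_radius_def \<tau>_def flip: \<delta>_def t_def)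
    qed auto
    also have "\<dots> \<le> ennreal \<gamma> * (SUP \<tau>\<in>{0..}. ?\<omega> \<tau>)"
      using \<open>0 \<le> \<tau>\<close> by (intro mult_left_mono SUP_upper) auto
    also have "\<dots> \<le> 2 * ennreal \<gamma> * (SUP \<tau>\<in>{0..}. ?\<omega> \<tau>)"
      using mult_right_mono[of 1 "2 :: ennreal" "ennreal \<gamma> * (SUP \<tau>\<in>{0..}. ?\<omega> \<tau>)"]
      by (simp add: mult.assoc)
    finally show ?thesis .
  qed
  finally show "(INF (Z, Q)\<in>?\<Q>. INF T\<in>estimators n Z L \<theta> \<Theta> \<P>.
        MAX P\<in>{P0, P1}. risk n L \<theta> Q T P)
      \<le> 2 * ennreal \<gamma> * (SUP \<tau>\<in>{0..}. ?\<omega> \<tau>)" .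
qed

end
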